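(* Let $(G,\beta)$ be an edge-labeled graph on vertices $v_1,\dots,v_n$, with module $m_j\mathbb{Z}$ at $v_j$ and module $\mathbb{Z}/r_{jl}\mathbb{Z}$ at each edge $v_jv_l$. For each $i=1,\dots,n$, let $\mathcal{P}^i$ be the set of the longest paths $P_{ji}$ of $v_i$ in $(G,\beta)$, and for each $P_{ji}\in\mathcal{P}^i$, with vertices in order starting from $v_i$, let $F_k=(f_{kv_i},f_{kv_{j_1}},\dots,f_{kv_{j_t}})$ be a minimal spline with $f_{kv_i}\neq0$ on $(P_{ji},\beta_{ji})$, where $\beta_{ji}=\beta|_{P_{ji}}$ (here $k$ indexes the longest paths in $\mathcal{P}^i$). Let $B=\{F^{(1)},\dots,F^{(n)}\}$ be a set of flow-up classes on $(G,\beta)$ where each $F^{(i)}=(0,\dots,0,f^{(i)}_{v_i},\dots,f^{(i)}_{v_n})\in\hat{\mathcal{F}}_i$ is minimal with the first nonzero entry $f^{(i)}_{v_i}$ equal to the least common multiple of all the $f_{kv_i}$, for $i=1,2,\dots,n$. Then $B$ forms a module basis over $\mathbb{Z}$ for $\hat{R}_G$.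
   Context: Setting: $G$ is a finite graph with ordered vertex set $\{v_1,\dots,v_n\}$, whose edges are unordered pairs of distinct vertices. Each vertex $v_j$ carries the $\mathbb{Z}$-module $m_j\mathbb{Z}$ ($m_j\in\mathbb{Z}$) and each edge $v_jv_l$ the $\mathbb{Z}$-module $\beta(v_jv_l)=\mathbb{Z}/r_{jl}\mathbb{Z}$ ($r_{jl}=r_{lj}\in\mathbb{Z}$). A spline on $(G,\beta)$ is a tuple of integers $(f_{v_1},\dots,f_{v_n})$ with $f_{v_j}\in m_j\mathbb{Z}$ for all $j$ and $f_{v_j}\equiv f_{v_l}\pmod{r_{jl}}$ for every edge $v_jv_l$; the $\mathbb{Z}$-module of all splines is $\hat{R}_G$. An $i$-th flow-up class is a spline with $f_{v_i}\ne0$ and $f_{v_s}=0$ for $s<i$; the set of these is $\hat{\mathcal{F}}_i$. The leading term of an element of $\hat{\mathcal{F}}_i$ is its entry at $v_i$; the leading terms of elements of $\hat{\mathcal{F}}_i$ (together with $0$) form an ideal of $\mathbb{Z}$, and $F^{(i)}\in\hat{\mathcal{F}}_i$ is minimal if its leading term generates this ideal. Longest paths: a trail from $v_j$ to $v_i$ is an ordered sequence of vertices and edges from $v_j$ to $v_i$ with no repeated edge, regarded as a path graph (so its vertices are distinct). A longest path $P_{ji}$ of $v_i$ is a trail ending at $v_i$ (starting from some vertex $v_j$) that is maximal under strict inclusion among all trails in $G$ ending at $v_i$. Minimal spline on a longest path $P_{ji}$ of $v_i$: order the vertices of $P_{ji}$ starting from its end $v_i$. A spline on $P_{ji}$ (with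 the vertex modules and edge labels inherited from $(G,\beta)$) with nonzero entry at $v_i$ is minimal if its entry at $v_i$ generates the ideal of $\mathbb{Z}$ consisting of all entries at $v_i$ of splines on $P_{ji}$. *)

theory Defs
  imports Complex_Main "HOL-Library.Function_Algebras" "HOL-Number_Theory.Cong"
begin

text \<open>A graph is a vertex set \<open>V\<close> of natural numbers (the number \<open>j\<close> stands for the vertex
  \<open>v\<^sub>j\<close>, so the vertex order is the order of the numbers) together with a set \<open>E\<close> of unordered
  pairs. The vertex \<open>j\<close> carries the module \<open>m j \<int>\<close> and the edge \<open>e\<close> the module
  \<open>\<int>/r e \<int>\<close>; as \<open>r\<close> is a function of the unordered pair, \<open>r {j, l} = r {l, j}\<close>.\<close>

definition is_graph :: "nat set \<Rightarrow> nat set set \<Rightarrow> bool" where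
  "is_graph V E \<longleftrightarrow> finite V \<and> (\<forall>e\<in>E. \<exists>j\<in>V. \<exists>l\<in>V. j \<noteq> l \<and> e = {j, l})"

text \<open>A tuple of integers indexed by \<open>V\<close> is a function vanishing outside \<open>V\<close>. For \<open>r {j, l} = 0\<close>
  the congruence is equality, as it has to be for \<open>\<int>/0\<int> = \<int>\<close>.\<close>

definition splines ::
  "nat set \<Rightarrow> nat set set \<Rightarrow> (nat \<Rightarrow> int) \<Rightarrow> (nat set \<Rightarrow> int) \<Rightarrow> (nat \<Rightarrow> int) set" where
  "splines V E m r =
    {f. (\<forall>j\<in>V. m j dvd f j) \<and>
        (\<forall>j l. {j, l} \<in> E \<longrightarrow> [f j = f l] (mod r {j, l})) \<and>
        (\<forall>j. j \<notin> V \<longrightarrow> f j = 0)}"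

definition int_scale :: "int \<Rightarrow> (nat \<Rightarrow> int) \<Rightarrow> (nat \<Rightarrow> int)" where
  "int_scale c f = (\<lambda>j. c * f j)"

global_interpretation int_fun: module int_scale
  by unfold_locales (auto simp: int_scale_def algebra_simps)

lemma subspace_splines: "int_fun.subspace (splines V E m r)"
  unfolding int_fun.subspace_def splines_def int_scale_def
  by (auto intro: cong_add cong_mult)

definition is_basis :: "(nat \<Rightarrow> int) set \<Rightarrow> (nat \<Rightarrow> int) set \<Rightarrow> bool" where
  "is_basis B M \<longleftrightarrow> int_fun.independent B \<and> int_fun.span B = M"

definition flow_up ::
  "nat set \<Rightarrow> nat set set \<Rightarrow> (nat \<Rightarrow> int) \<Rightarrow> (nat set \<Rightarrow> int) \<Rightarrow> nat \<Rightarrow> (nat \<Rightarrow> int) set" where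
  "flow_up V E m r i = {f \<in> splines V E m r. f i \<noteq> 0 \<and> (\<forall>s\<in>V. s < i \<longrightarrow> f s = 0)}"

definition leading_ideal ::
  "nat set \<Rightarrow> nat set set \<Rightarrow> (nat \<Rightarrow> int) \<Rightarrow> (nat set \<Rightarrow> int) \<Rightarrow> nat \<Rightarrow> int set" where
  "leading_ideal V E m r i = insert 0 ((\<lambda>f. f i) ` flow_up V E m r i)"

definition principal_ideal :: "int \<Rightarrow> int set" where
  "principal_ideal a = {c * a | c. True}"

definition minimal_flow_up ::
  "nat set \<Rightarrow> nat set set \<Rightarrow> (nat \<Rightarrow> int) \<Rightarrow> (nat set \<Rightarrow> int) \<Rightarrow> nat \<Rightarrow> (nat \<Rightarrow> int) \<Rightarrow> bool" where
  "minimal_flow_up V E m r i f \<longleftrightarrow>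
    f \<in> flow_up V E m r i \<and> principal_ideal (f i) = leading_ideal V E m r i"

text \<open>A trail is given by the list of its vertices. The one-vertex trail \<open>[i]\<close> is allowed; it is
  a longest path of \<open>i\<close> exactly if \<open>i\<close> is isolated.\<close>

definition edges_of :: "nat list \<Rightarrow> nat set list" where
  "edges_of p = map (\<lambda>k. {p ! k, p ! Suc k}) [0..<length p - 1]"

definition trails_to :: "nat set \<Rightarrow> nat set set \<Rightarrow> nat \<Rightarrow> nat list set" where
  "trails_to V E i =
    {p. p \<noteq> [] \<and> last p = i \<and> set p \<subseteq> V \<and> set (edges_of p) \<subseteq> E \<and>
        distinct (edges_of p) \<and> distinct p}"

definition trail_subset :: "nat list \<Rightarrow> nat list \<Rightarrow> bool" where
  "trail_subset p q \<longleftrightarrow>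
    set p \<subseteq> set q \<and> set (edges_of p) \<subseteq> set (edges_of q) \<and>
    (set p \<noteq> set q \<or> set (edges_of p) \<noteq> set (edges_of q))"

definition longest_paths :: "nat set \<Rightarrow> nat set set \<Rightarrow> nat \<Rightarrow> nat list set" where
  "longest_paths V E i =
    {p \<in> trails_to V E i. \<not> (\<exists>q\<in>trails_to V E i. trail_subset p q)}"

text \<open>The graph of the path \<open>p\<close> has the edges of \<open>p\<close> only, not all edges of the ambient graph
  between its vertices. In the order that starts from the end \<open>i\<close> of \<open>p\<close> no vertex precedes \<open>i\<close>,
  so no entry is required to vanish.\<close>

definition minimal_path_spline ::
  "(nat \<Rightarrow> int) \<Rightarrow> (nat set \<Rightarrow> int) \<Rightarrow> nat list \<Rightarrow> nat \<Rightarrow> (nat \<Rightarrow> int) \<Rightarrow> bool" where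
  "minimal_path_spline m r p i f \<longleftrightarrow>
    f \<in> splines (set p) (set (edges_of p)) m r \<and> f i \<noteq> 0 \<and>
    principal_ideal (f i) = (\<lambda>g. g i) ` splines (set p) (set (edges_of p)) m r"

end

theory Submission
  imports Defs
begin

text \<open>The matrix of the flow-up classes is triangular with nonzero diagonal, which gives
  independence. A spline whose first nonzero entry is at \<open>v\<^sub>i\<close> has a multiple of
  \<open>f\<^bsup>(i)\<^esup>\<^bsub>v\<^sub>i\<^esub>\<close> as this entry by minimality, so subtracting a multiple of \<open>F\<^bsup>(i)\<^esup>\<close>
  moves the first nonzero entry further right; after finitely many steps nothing is left.\<close>

lemma sum_int_scale_apply:
  "(\<Sum>v\<in>A. int_scale (u v) v) i = (\<Sum>v\<in>A. u v * v i)"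
  by (induction A rule: infinite_finite_induct) (auto simp: int_scale_def)

text \<open>In a vanishing combination with some nonzero coefficient, the entry at the least index
  that carries a nonzero coefficient receives a contribution from one vector only, and the diagonal
  makes it nonzero.\<close>

lemma independent_triangular:
  assumes diag: "\<And>i. i \<in> V \<Longrightarrow> F i i \<noteq> 0"
    and lower: "\<And>i s. i \<in> V \<Longrightarrow> s \<in> V \<Longrightarrow> s < i \<Longrightarrow> F i s = 0"
  shows "int_fun.independent (F ` V)"
proof
  assume "int_fun.dependent (F ` V)"
  then obtain t u where t: "finite t" "t \<subseteq> F ` V" "(\<Sum>v\<in>t. int_scale (u v) v) = 0"
    and ex: "\<exists>v\<in>t. u v \<noteq> 0"
    unfolding int_fun.dependent_explicit by blast
  \<comment> \<open>The coefficients \<open>u\<close> belong to vectors; passing to indices gives an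
    order in which to pick a least one.\<close>
  define I where "I = {i\<in>V. F i \<in> t \<and> u (F i) \<noteq> 0}"
  define i where "i = (LEAST i. i \<in> I)"
  have "\<exists>i. i \<in> I" using ex t(2) unfolding I_def by blast
  then have iI: "i \<in> I" unfolding i_def by (rule LeastI_ex)
  then have i: "i \<in> V" "F i \<in> t" "u (F i) \<noteq> 0" unfolding I_def by auto
  \<comment> \<open>A further vector with nonzero coefficient is some \<open>F j\<close> with
    \<open>j\<close> in \<open>I\<close>. Being different from \<open>F i\<close> it has j \<noteq>
    i, so leastness gives i < j and triangularity kills its entry at \<open>i\<close>.\<close>
  have zero: "u v * v i = 0" if "v \<in> t - {F i}" for v
  proof (cases "u v = 0")
    case False
    obtain j where j: "j \<in> V" "v = F j" using \<open>v \<in> t - {F i}\<close> t(2) by blast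
    then have "j \<in> I" "j \<noteq> i" using False \<open>v \<in> t - {F i}\<close> unfolding I_def by auto
    then have "i < j" unfolding i_def by (metis Least_le le_neq_implies_less)
    then show ?thesis using lower j i(1) by simp
  qed simp
  have "0 = (\<Sum>v\<in>t. u v * v i)"
    using t(3) by (metis sum_int_scale_apply zero_fun_apply)
  also have "\<dots> = u (F i) * F i i"
    using sum.neutral[of "t - {F i}" "\<lambda>v. u v * v i"] zero
    by (simp add: sum.remove[OF t(1) i(2)] del: mult_eq_0_iff)
  finally show False using i diag by simp
qed

text \<open>The bound \<open>k\<close> is there for the induction, which runs on the number of
  vertices not below \<open>k\<close>: one reduction may jump from \<open>k\<close> to any later
  position.\<close>

lemma spline_in_span_minimal_flow_up:
  assumes fin: "finite V"
    and min: "\<And>i. i \<in> V \<Longrightarrow> minimal_flow_up V E m r i (F i)"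
    and "g \<in> splines V E m r" "\<forall>s\<in>V. s < k \<longrightarrow> g s = 0"
  shows "g \<in> int_fun.span (F ` V)"
  using assms(3,4)
proof (induction "card {s\<in>V. k \<le> s}" arbitrary: k g rule: less_induct)
  case less
  show ?case
  proof (cases "{s\<in>V. g s \<noteq> 0} = {}")
    case True
    \<comment> \<open>Splines vanish off \<open>V\<close> by definition, so vanishing on
      \<open>V\<close> suffices.\<close>
    then have "g = 0" using less.prems(1) by (auto simp: splines_def fun_eq_iff)
    then show ?thesis by (simp add: int_fun.span_zero)
  next
    case False
    define i where "i = Min {s\<in>V. g s \<noteq> 0}"
    have i: "i \<in> V" "g i \<noteq> 0"
      using Min_in[OF _ False] fin unfolding i_def by auto
    have low: "g s = 0" if "s \<in> V" "s < i" for s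
      using that Min_le[of "{s\<in>V. g s \<noteq> 0}" s] fin unfolding i_def by fastforce
    have "k \<le> i" using i less.prems(2) by (meson not_le)
    have "g \<in> flow_up V E m r i" using less.prems(1) i low by (auto simp: flow_up_def)
    then have "g i \<in> principal_ideal (F i i)"
      using min[OF i(1)] by (auto simp: minimal_flow_up_def leading_ideal_def)
    then obtain c where c: "g i = c * F i i" by (auto simp: principal_ideal_def)
    have Fi: "F i \<in> splines V E m r" "\<And>s. s \<in> V \<Longrightarrow> s < i \<Longrightarrow> F i s = 0"
      using min[OF i(1)] by (auto simp: minimal_flow_up_def flow_up_def)
    define h where "h = g - int_scale c (F i)"
    have "h \<in> splines V E m r"
      unfolding h_def using less.prems(1) Fi(1) subspace_splines
      by (intro int_fun.subspace_diff int_fun.subspace_scale)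
    moreover have "\<forall>s\<in>V. s < Suc i \<longrightarrow> h s = 0"
      using low Fi(2) c by (auto simp: h_def int_scale_def less_Suc_eq)
    moreover have "card {s\<in>V. Suc i \<le> s} < card {s\<in>V. k \<le> s}"
    proof (rule psubset_card_mono)
      \<comment> \<open>The vertex \<open>i\<close> itself is lost from the count, even when several
        positions are skipped.\<close>
      have "i \<in> {s\<in>V. k \<le> s} - {s\<in>V. Suc i \<le> s}" using i(1) \<open>k \<le> i\<close> by simp
      moreover have "{s\<in>V. Suc i \<le> s} \<subseteq> {s\<in>V. k \<le> s}" using \<open>k \<le> i\<close> by auto
      ultimately show "{s\<in>V. Suc i \<le> s} \<subset> {s\<in>V. k \<le> s}" by blast
    qed (use fin in simp)
    ultimately have "h \<in> int_fun.span (F ` V)" using less.hyps by blast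
    then have "h + int_scale c (F i) \<in> int_fun.span (F ` V)"
      by (rule int_fun.span_add[OF _ int_fun.span_scale[OF int_fun.span_base]]) (use i(1) in simp)
    then show ?thesis by (simp add: h_def)
  qed
qed

lemma minimal_flow_up_basis:
  assumes "finite V" and min: "\<And>i. i \<in> V \<Longrightarrow> minimal_flow_up V E m r i (F i)"
  shows "is_basis (F ` V) (splines V E m r)"
proof -
  have F: "F i \<in> flow_up V E m r i" if "i \<in> V" for i
    using min[OF that] by (simp add: minimal_flow_up_def)
  then have "int_fun.span (F ` V) \<subseteq> splines V E m r"
    by (intro int_fun.span_minimal subspace_splines) (auto simp: flow_up_def)
  \<comment> \<open>At k = 0 the condition on earlier entries is vacuous, so every spline is
    covered.\<close>
  moreover have "splines V E m r \<subseteq> int_fun.span (F ` V)"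
    using spline_in_span_minimal_flow_up[OF assms, where k = 0] by auto
  moreover have "int_fun.independent (F ` V)"
    using F by (intro independent_triangular) (auto simp: flow_up_def)
  ultimately show ?thesis unfolding is_basis_def by blast
qed

theorem theorem6p14:
  fixes n :: nat
    and E :: "nat set set"
    and m :: "nat \<Rightarrow> int"
    and r :: "nat set \<Rightarrow> int"
    and f :: "nat \<Rightarrow> nat list \<Rightarrow> nat \<Rightarrow> int"
    and F :: "nat \<Rightarrow> nat \<Rightarrow> int"
  assumes "is_graph {1..n} E"
    and "\<forall>i\<in>{1..n}. \<forall>p\<in>longest_paths {1..n} E i. minimal_path_spline m r p i (f i p)"
    and "\<forall>i\<in>{1..n}. minimal_flow_up {1..n} E m r i (F i)"
    and "\<forall>i\<in>{1..n}. F i i = Lcm ((\<lambda>p. f i p i) ` longest_paths {1..n} E i)"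
  shows "is_basis (F ` {1..n}) (splines {1..n} E m r)"
  using assms(3) by (intro minimal_flow_up_basis) auto

end
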